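(* For all complex $q$ with $|q|<1$, \[ \sum_{i,j\geq 0} \frac{q^{4i^2+4ij+2j^2}}{(q;q)_{2i}(q^2;q^2)_j} =\frac{(-q^5,-q^7,q^{12};q^{12})_\infty}{(q^2;q^2)_\infty}, \qquad \sum_{i,j\geq 0} \frac{q^{4i^2+4ij+2j^2+4i+2j}}{(q;q)_{2i+1}(q^2;q^2)_j}=\frac{(-q,-q^{11},q^{12};q^{12})_\infty}{(q^2;q^2)_\infty}. \]
   Context: For $|q|<1$ and $n\in\mathbb{Z}_{\geq0}\cup\{\infty\}$: $(a;q)_0=1$, $(a;q)_n=\prod_{k=0}^{n-1}(1-aq^k)$, $(a;q)_\infty=\prod_{k\geq0}(1-aq^k)$, and $(a_1,\dots,a_m;q)_n=(a_1;q)_n\cdots(a_m;q)_n$. *)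

theory Defs
  imports "HOL-Analysis.Analysis"
begin

definition qpoch :: "complex \<Rightarrow> complex \<Rightarrow> nat \<Rightarrow> complex" where
  "qpoch a q n = (\<Prod>k<n. 1 - a * q ^ k)"

definition qpoch_inf :: "complex \<Rightarrow> complex \<Rightarrow> complex" where
  "qpoch_inf a q = (\<Prod>k. 1 - a * q ^ k)"

end

theory Submission
  imports Defs
begin

text \<open>
  Put \<open>Q = q\<^sup>2\<close>, \<open>n = i + j\<close> and let \<open>d = 0\<close> for the first identity, \<open>d = 1\<close> for the second. The
  exponent of \<open>q\<close> is \<open>2(n\<^sup>2 + dn) + 2(i\<^sup>2 + di)\<close>, so the double sum has the shape of two successive
  applications of the limiting Bailey lemma in base \<open>Q\<close> with \<open>a = Q\<^sup>d\<close> to the sequence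
  \<open>\<beta>\<^sub>i = 1/(q;q)\<^bsub>2i+d\<^esub>\<close>, whose Bailey pair expansion is
  \<open>\<beta>\<^sub>i = \<Sum>\<^sub>r q\<^bsup>2r\<^sup>2+r\<^esup> / ((Q;Q)\<^bsub>i-r\<^esub> (Q;Q)\<^bsub>i+r+d\<^esub>)\<close>. Each application multiplies the \<open>r\<close>-th term
  by \<open>Q\<^bsup>r\<^sup>2+dr\<^esup>\<close>, which leaves \<open>\<Sum>\<^sub>r q\<^bsup>6r\<^sup>2+(1+4d)r\<^esup> / (Q;Q)\<^sub>\<infinity>\<close>, and the Jacobi triple product
  evaluates this theta series.
\<close>

section \<open>Dominated convergence and geometric majorants for unordered sums\<close>

lemma has_sum_diff:
  fixes f g :: "'a \<Rightarrow> 'b::topological_ab_group_add"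
  assumes "(f has_sum a) A" "(g has_sum b) A"
  shows "((\<lambda>x. f x - g x) has_sum (a - b)) A"
  using assms unfolding has_sum_def sum_subtractf by (rule tendsto_diff)

text \<open>Outside a finite set \<open>G\<close> the sums of all \<open>f n\<close> are bounded by
  the tail of \<open>h\<close>, uniformly in \<open>n\<close>. Letting \<open>n\<close> tend to
  infinity for fixed \<open>G\<close>, and only then enlarging \<open>G\<close>, yields both
  existence and value of the limiting sum.\<close>

lemma has_sum_dominated_convergence:
  fixes f :: "nat \<Rightarrow> 'a \<Rightarrow> 'b::real_normed_vector" and h :: "'a \<Rightarrow> real"
  assumes h: "h summable_on A"
    and bound: "\<And>n x. x \<in> A \<Longrightarrow> norm (f n x) \<le> h x"
    and lim: "\<And>x. x \<in> A \<Longrightarrow> (\<lambda>n. f n x) \<longlonglongrightarrow> g x"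
    and sum: "\<And>n. (f n has_sum S n) A"
    and S: "S \<longlonglongrightarrow> L"
  shows "(g has_sum L) A"
proof -
  define H where "H = infsum h A"
  have H: "(h has_sum H) A"
    unfolding H_def using h by simp
  \<comment> \<open>The tail is written as a sum over all of \<open>A\<close> whose terms on
    \<open>G\<close> are cancelled by subtraction.\<close>
  have tail: "norm (S n - sum (f n) G) \<le> H - sum h G" if G: "finite G" "G \<subseteq> A" for n G
  proof (rule norm_infsum_le)
    show "((\<lambda>x. f n x - (if x \<in> G then f n x else 0)) has_sum (S n - sum (f n) G)) A"
      by (intro has_sum_diff sum has_sum_finite_neutralI[of G]) (use G in auto)
    show "((\<lambda>x. h x - (if x \<in> G then h x else 0)) has_sum (H - sum h G)) A"
      by (intro has_sum_diff H has_sum_finite_neutralI[of G]) (use G in auto)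
  qed (use bound in auto)
  have tail_lim: "norm (L - sum g G) \<le> H - sum h G" if G: "finite G" "G \<subseteq> A" for G
  proof (rule tendsto_upperbound)
    show "(\<lambda>n. norm (S n - sum (f n) G)) \<longlonglongrightarrow> norm (L - sum g G)"
      by (intro tendsto_intros S lim) (use G in auto)
  qed (use tail[OF G] in auto)
  show ?thesis
    unfolding has_sum_def tendsto_iff
  proof (intro allI impI)
    fix e :: real assume "e > 0"
    then have "\<forall>\<^sub>F G in finite_subsets_at_top A. dist (sum h G) H < e"
      using H unfolding has_sum_def tendsto_iff by blast
    moreover have "\<forall>\<^sub>F G in finite_subsets_at_top A. norm (L - sum g G) \<le> H - sum h G"
      by (rule eventually_finite_subsets_at_top_weakI) (rule tail_lim)
    ultimately show "\<forall>\<^sub>F G in finite_subsets_at_top A. dist (sum g G) L < e"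
      by eventually_elim (auto simp: dist_norm norm_minus_commute)
  qed
qed

lemma summable_on_power_nat:
  fixes x :: real
  assumes "0 \<le> x" "x < 1"
  shows "(\<lambda>n::nat. x ^ n) summable_on UNIV"
  using assms by (subst summable_on_UNIV_nonneg_real_iff) (auto intro: summable_geometric)

lemma summable_on_power_abs_int:
  fixes x :: real
  assumes x: "0 \<le> x" "x < 1"
  shows "(\<lambda>r::int. x ^ nat \<bar>r\<bar>) summable_on UNIV"
proof -
  have "(\<lambda>r::int. x ^ nat \<bar>r\<bar>) summable_on {0..}"
    using summable_on_power_nat[OF x]
    by (subst summable_on_reindex_bij_witness[of _ int nat UNIV "\<lambda>n. x ^ n"]) auto
  moreover have "(\<lambda>r::int. x ^ nat \<bar>r\<bar>) summable_on {..<0}"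
  proof (subst summable_on_reindex_bij_witness[of _ "\<lambda>n. - int n - 1" "\<lambda>r. nat (- r - 1)" UNIV "\<lambda>n. x * x ^ n"])
    show "(\<lambda>n::nat. x * x ^ n) summable_on UNIV"
      by (intro summable_on_cmult_right summable_on_power_nat x)
    fix r :: int assume "r \<in> {..<0}"
    then have "nat \<bar>r\<bar> = Suc (nat (- r - 1))" by auto
    then show "x * x ^ nat (- r - 1) = x ^ nat \<bar>r\<bar>" by simp
  qed auto
  ultimately have "(\<lambda>r::int. x ^ nat \<bar>r\<bar>) summable_on ({0..} \<union> {..<0})"
    by (intro summable_on_Un_disjoint) auto
  moreover have "{0..} \<union> {..<0} = (UNIV :: int set)"
    by auto
  ultimately show ?thesis by simp
qed

section \<open>q-shifted factorials and their reciprocals at integer arguments\<close>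

lemma convergent_prod_qpoch:
  assumes "norm q < 1"
  shows "convergent_prod (\<lambda>k. 1 - a * q ^ k :: complex)"
proof (rule abs_convergent_prod_imp_convergent_prod, rule summable_imp_abs_convergent_prod)
  show "summable (\<lambda>k. norm (1 - a * q ^ k - 1))"
    using assms by (auto simp: norm_mult norm_power intro!: summable_mult summable_geometric)
qed

lemma qpoch_tendsto:
  assumes "norm q < 1"
  shows "qpoch a q \<longlonglongrightarrow> qpoch_inf a q"
  using convergent_prod_LIMSEQ[OF convergent_prod_qpoch[OF assms, of a]]
  unfolding qpoch_def qpoch_inf_def LIMSEQ_lessThan_iff_atMost .

lemma qpoch_Suc: "qpoch a q (Suc n) = qpoch a q n * (1 - a * q ^ n)"
  by (simp add: qpoch_def)

lemma power_neq_1: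
  fixes q :: complex
  assumes "norm q < 1" "k > 0"
  shows "q ^ k \<noteq> 1"
  using assms by (metis norm_one norm_power power_less_one_iff less_irrefl norm_ge_zero)

lemma qpoch_self_nonzero:
  assumes "norm q < 1"
  shows "qpoch q q n \<noteq> 0"
  using power_neq_1[OF assms, of "Suc k" for k] by (auto simp: qpoch_def)

lemma qpoch_inf_self_nonzero:
  assumes "norm q < 1"
  shows "qpoch_inf q q \<noteq> 0"
  unfolding qpoch_inf_def
  using power_neq_1[OF assms, of "Suc k" for k]
  by (intro prodinf_nonzero convergent_prod_qpoch assms) auto

text \<open>The convention \<open>1/(q;q)\<^sub>k = 0\<close> for \<open>k < 0\<close> makes the recurrence
  \<open>(1 - q\<^sup>k) / (q;q)\<^sub>k = 1 / (q;q)\<^bsub>k-1\<^esub>\<close> valid for all integers \<open>k\<close>.\<close>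

definition inv_qfact :: "complex \<Rightarrow> int \<Rightarrow> complex" where
  "inv_qfact q k = (if k < 0 then 0 else 1 / qpoch q q (nat k))"

lemma inv_qfact_neg [simp]: "k < 0 \<Longrightarrow> inv_qfact q k = 0"
  by (simp add: inv_qfact_def)

lemma inv_qfact_0 [simp]: "inv_qfact q 0 = 1"
  by (simp add: inv_qfact_def qpoch_def)

lemma inv_qfact_of_nat: "inv_qfact q (int n) = 1 / qpoch q q n"
  by (simp add: inv_qfact_def)

lemma inv_qfact_rec:
  assumes "norm q < 1"
  shows "inv_qfact q (k - 1) = (1 - q powi k) * inv_qfact q k"
proof (cases "k > 0")
  case True
  then obtain n where k: "k = int (Suc n)"
    by (metis pos_int_cases gr0_implies_Suc)
  have "inv_qfact q (k - 1) = 1 / qpoch q q n"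
    unfolding k by (simp add: inv_qfact_def)
  moreover have "inv_qfact q k = 1 / (qpoch q q n * (1 - q * q ^ n))"
    unfolding k inv_qfact_of_nat qpoch_Suc ..
  moreover have "q powi k = q * q ^ n"
    unfolding k power_int_of_nat by simp
  moreover have "1 - q * q ^ n \<noteq> 0"
    using power_neq_1[OF assms, of "Suc n"] by auto
  ultimately show ?thesis
    by simp
qed (cases "k = 0"; simp)

text \<open>The integer shift \<open>c\<close> covers the arguments \<open>n - r\<close>,
  \<open>n + r\<close>, \<open>n - i\<close> and \<open>n + r + d\<close> that occur in the limits
  below.\<close>

lemma inv_qfact_tendsto:
  assumes "norm q < 1"
  shows "(\<lambda>n. inv_qfact q (int n + c)) \<longlonglongrightarrow> 1 / qpoch_inf q q"
proof -
  have "(\<lambda>n. 1 / qpoch q q n) \<longlonglongrightarrow> 1 / qpoch_inf q q"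
    by (intro tendsto_intros qpoch_tendsto qpoch_inf_self_nonzero assms)
  moreover have "filterlim (\<lambda>n. nat (int n + c)) at_top sequentially"
    unfolding filterlim_at_top
  proof
    fix Z show "\<forall>\<^sub>F n in sequentially. Z \<le> nat (int n + c)"
      using eventually_ge_at_top[of "Z + nat \<bar>c\<bar>"] by eventually_elim auto
  qed
  ultimately have "(\<lambda>n. 1 / qpoch q q (nat (int n + c))) \<longlonglongrightarrow> 1 / qpoch_inf q q"
    by (rule filterlim_compose)
  moreover have "\<forall>\<^sub>F n in sequentially. 1 / qpoch q q (nat (int n + c)) = inv_qfact q (int n + c)"
    using eventually_ge_at_top[of "nat \<bar>c\<bar>"] by eventually_elim (auto simp: inv_qfact_def)
  ultimately show ?thesis
    by (rule Lim_transform_eventually)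
qed

text \<open>Provides the constant factor of the majorants in the limit and interchange
  arguments.\<close>

lemma inv_qfact_bounded:
  assumes "norm q < 1"
  obtains C where "C > 0" "\<And>k. norm (inv_qfact q k) \<le> C"
proof -
  have "Bseq (\<lambda>n. inv_qfact q (int n + 0))"
    using inv_qfact_tendsto[OF assms] by (intro convergent_imp_Bseq convergentI)
  then obtain C where C: "C > 0" "\<And>n. norm (inv_qfact q (int n)) \<le> C"
    by (auto simp: Bseq_def)
  have "norm (inv_qfact q k) \<le> C" for k
    using C(1) C(2)[of "nat k"] by (cases "k < 0") auto
  with C(1) show ?thesis using that by blast
qed

section \<open>Finite theta sums and the Jacobi triple product\<close>

text \<open>With \<open>c r = a\<^bsup>r(r+1)/2\<^esup> b\<^bsup>r(r-1)/2\<^esup>\<close> and \<open>q = ab\<close> the sums below are finite forms of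
  Ramanujan's theta function \<open>f(a, b)\<close>.\<close>

lemma finite_theta_step:
  assumes q: "norm q < 1" "q \<noteq> 0"
    and c: "\<And>r. c (r + 1) = a * q powi r * c r"
  shows "(1 - q ^ (m + n + 1)) *
           (\<Sum>r = - int n..int (Suc m). c r * inv_qfact q (int (Suc m) - r) * inv_qfact q (int n + r)) =
         (1 + a * q ^ m) *
           (\<Sum>r = - int n..int m. c r * inv_qfact q (int m - r) * inv_qfact q (int n + r))"
proof -
  let ?g = "inv_qfact q"
  \<comment> \<open>Splits \<open>1 - x y = (1 - x) + x (1 - y)\<close> with
    \<open>x = q powi (m + 1 - r)\<close> and \<open>y = q powi (n + r)\<close>; each factor lowers
    one argument of \<open>inv_qfact\<close> by one.\<close>
  have pascal: "(1 - q ^ (m + n + 1)) * (c r * ?g (int (Suc m) - r) * ?g (int n + r)) =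
      c r * ?g (int m - r) * ?g (int n + r) +
      q powi (int m + 1 - r) * c r * ?g (int m + 1 - r) * ?g (int n + r - 1)" for r
  proof -
    have e: "q ^ (m + n + 1) = q powi (int m + 1 - r) * q powi (int n + r)"
      using q by (simp add: ac_simps flip: power_int_of_nat power_int_add)
    have g: "?g (int m - r) = (1 - q powi (int m + 1 - r)) * ?g (int m + 1 - r)"
      using inv_qfact_rec[OF q(1), of "int m + 1 - r"] by (simp add: algebra_simps)
    show ?thesis
      unfolding e g inv_qfact_rec[OF q(1), of "int n + r"] by (simp add: algebra_simps)
  qed
  have first: "(\<Sum>r = - int n..int (Suc m). c r * ?g (int m - r) * ?g (int n + r)) =
      (\<Sum>r = - int n..int m. c r * ?g (int m - r) * ?g (int n + r))"
    by (rule sum.mono_neutral_right) auto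
  \<comment> \<open>The term \<open>r = - n\<close> vanishes because it contains
    \<open>inv_qfact q (- 1)\<close>. Shifting \<open>r\<close> by one and using the recurrence of
    \<open>c\<close> then gives back the first sum, times \<open>a * q ^ m\<close>.\<close>
  have "(\<Sum>r = - int n..int (Suc m). q powi (int m + 1 - r) * c r * ?g (int m + 1 - r) * ?g (int n + r - 1)) =
      (\<Sum>r = - int n + 1..int (Suc m). q powi (int m + 1 - r) * c r * ?g (int m + 1 - r) * ?g (int n + r - 1))"
    by (rule sum.mono_neutral_right) auto
  also have "\<dots> = (\<Sum>r = - int n..int m. a * q ^ m * (c r * ?g (int m - r) * ?g (int n + r)))"
  proof (rule sum.reindex_bij_witness[of _ "\<lambda>r. r + 1" "\<lambda>r. r - 1"])
    fix r assume "r \<in> {- int n + 1..int (Suc m)}"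
    have "c r = a * q powi (r - 1) * c (r - 1)"
      using c[of "r - 1"] by simp
    moreover have "q ^ m = q powi (int m + 1 - r) * q powi (r - 1)"
      using q by (simp flip: power_int_of_nat power_int_add)
    ultimately show "a * q ^ m * (c (r - 1) * ?g (int m - (r - 1)) * ?g (int n + (r - 1))) =
        q powi (int m + 1 - r) * c r * ?g (int m + 1 - r) * ?g (int n + r - 1)"
      by (simp add: algebra_simps)
  qed auto
  finally have second: "(\<Sum>r = - int n..int (Suc m). q powi (int m + 1 - r) * c r * ?g (int m + 1 - r) * ?g (int n + r - 1)) =
      a * q ^ m * (\<Sum>r = - int n..int m. c r * ?g (int m - r) * ?g (int n + r))"
    by (simp add: sum_distrib_left)
  show ?thesis
    unfolding sum_distrib_left[of "1 - q ^ (m + n + 1)"] pascal sum.distrib first second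
    by (simp add: algebra_simps)
qed

text \<open>Each application of \<open>finite_theta_step\<close> appends one factor of the first
  product. The base case \<open>m = 0\<close> is itself an induction on \<open>n\<close>, using the
  same step for the reflected sequence \<open>c (- r)\<close> with \<open>b\<close> in the role of
  \<open>a\<close>.\<close>

lemma finite_theta:
  assumes q: "norm q < 1" "q \<noteq> 0"
    and c0: "c 0 = 1"
    and ca: "\<And>r. c (r + 1) = a * q powi r * c r"
    and cb: "\<And>r. c (- (r + 1)) = b * q powi r * c (- r)"
  shows "qpoch (- a) q m * qpoch (- b) q n =
    qpoch q q (m + n) * (\<Sum>r = - int n..int m. c r * inv_qfact q (int m - r) * inv_qfact q (int n + r))"
proof (induction m)
  case 0
  have flip: "(\<Sum>r = - int n..int m. c r * inv_qfact q (int m - r) * inv_qfact q (int n + r)) =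
      (\<Sum>r = - int m..int n. c (- r) * inv_qfact q (int n - r) * inv_qfact q (int m + r))" for m n
    by (rule sum.reindex_bij_witness[of _ uminus uminus]) auto
  show ?case
  proof (induction n)
    case 0
    then show ?case by (simp add: qpoch_def c0)
  next
    case (Suc n)
    have "qpoch q q (0 + Suc n) * (\<Sum>r = - int (Suc n)..int 0. c r * inv_qfact q (int 0 - r) * inv_qfact q (int (Suc n) + r)) =
      qpoch q q n * ((1 - q ^ (n + 0 + 1)) * (\<Sum>r = - int 0..int (Suc n). c (- r) * inv_qfact q (int (Suc n) - r) * inv_qfact q (int 0 + r)))"
      unfolding flip[of 0 "Suc n"] by (simp add: qpoch_Suc)
    also have "\<dots> = (1 + b * q ^ n) * (qpoch q q n * (\<Sum>r = - int 0..int n. c (- r) * inv_qfact q (int n - r) * inv_qfact q (int 0 + r)))"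
      unfolding finite_theta_step[OF q, of "\<lambda>r. c (- r)" b n 0, OF cb] by (simp add: algebra_simps)
    also have "\<dots> = (1 + b * q ^ n) * (qpoch (- a) q 0 * qpoch (- b) q n)"
      using Suc.IH unfolding flip[of 0 n] by simp
    finally show ?case
      by (simp add: qpoch_Suc algebra_simps)
  qed
next
  case (Suc m)
  have "qpoch q q (Suc m + n) * (\<Sum>r = - int n..int (Suc m). c r * inv_qfact q (int (Suc m) - r) * inv_qfact q (int n + r)) =
    qpoch q q (m + n) * ((1 - q ^ (m + n + 1)) * (\<Sum>r = - int n..int (Suc m). c r * inv_qfact q (int (Suc m) - r) * inv_qfact q (int n + r)))"
    by (simp add: qpoch_Suc)
  also have "\<dots> = (1 + a * q ^ m) * (qpoch (- a) q m * qpoch (- b) q n)"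
    unfolding finite_theta_step[OF q ca] Suc.IH by (simp add: algebra_simps)
  finally show ?case
    by (simp add: qpoch_Suc algebra_simps)
qed

text \<open>Take \<open>m = n\<close> in \<open>finite_theta\<close>, divide by
  \<open>qpoch q q (2 * n)\<close> and let \<open>n\<close> tend to infinity. Both reciprocal
  factors tend to \<open>1 / P\<close>, so the limit is the theta series over \<open>P * P\<close>,
  and multiplying by \<open>P * P\<close> finishes.\<close>

theorem jacobi_triple_product_has_sum:
  assumes q: "norm q < 1" "q \<noteq> 0"
    and c0: "c 0 = 1"
    and ca: "\<And>r. c (r + 1) = a * q powi r * c r"
    and cb: "\<And>r. c (- (r + 1)) = b * q powi r * c (- r)"
    and summable: "(\<lambda>r. norm (c r)) summable_on UNIV"
  shows "(c has_sum (qpoch_inf (- a) q * qpoch_inf (- b) q * qpoch_inf q q)) UNIV"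
proof -
  obtain C where C: "C > 0" "\<And>k. norm (inv_qfact q k) \<le> C"
    using inv_qfact_bounded[OF q(1)] by blast
  define P where "P = qpoch_inf q q"
  have P: "P \<noteq> 0"
    unfolding P_def by (rule qpoch_inf_self_nonzero[OF q(1)])
  have "((\<lambda>r. c r * (1 / P) * (1 / P)) has_sum (qpoch_inf (- a) q * qpoch_inf (- b) q / P)) UNIV"
  proof (rule has_sum_dominated_convergence)
    show "(\<lambda>r. norm (c r) * C * C) summable_on UNIV"
      by (intro summable_on_cmult_left summable)
    show "norm (c r * inv_qfact q (int n + (- r)) * inv_qfact q (int n + r)) \<le> norm (c r) * C * C" for n r
      unfolding norm_mult using C by (intro mult_mono) auto
    show "(\<lambda>n. c r * inv_qfact q (int n + (- r)) * inv_qfact q (int n + r)) \<longlonglongrightarrow> c r * (1 / P) * (1 / P)" for r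
      unfolding P_def by (intro tendsto_intros inv_qfact_tendsto q)
    show "((\<lambda>r. c r * inv_qfact q (int n + (- r)) * inv_qfact q (int n + r)) has_sum
        (qpoch (- a) q n * qpoch (- b) q n / qpoch q q (n + n))) UNIV" for n
      using qpoch_self_nonzero[OF q(1)]
      by (intro has_sum_finite_neutralI[of "{- int n..int n}"])
         (auto simp: finite_theta[OF q c0 ca cb] not_le)
    have "filterlim (\<lambda>n::nat. n + n) at_top at_top"
      by (intro filterlim_subseq strict_monoI) auto
    with qpoch_tendsto[OF q(1)] have "(\<lambda>n. qpoch q q (n + n)) \<longlonglongrightarrow> P"
      unfolding P_def by (rule filterlim_compose)
    then show "(\<lambda>n. qpoch (- a) q n * qpoch (- b) q n / qpoch q q (n + n)) \<longlonglongrightarrow>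
        qpoch_inf (- a) q * qpoch_inf (- b) q / P"
      using P by (intro tendsto_intros qpoch_tendsto q)
  qed
  from has_sum_cmult_left[OF this, of "P * P"] show ?thesis
    using P by (simp add: field_simps flip: P_def)
qed

section \<open>The Bailey pair expansion of the reciprocals of
  \<open>qpoch q q (2 * i + d)\<close>\<close>

text \<open>The odd and even sums determine each other because the correction terms produced by the recurrence
  of \<open>1/(Q;Q)\<^sub>k\<close> are, after the reflections \<open>r \<mapsto> - 1 - r\<close> and \<open>r \<mapsto> - r\<close>, multiples of the sums themselves.\<close>

lemma inv_qpoch_expansion_even_odd:
  assumes q: "norm q < 1" "q \<noteq> 0"
  defines "g \<equiv> inv_qfact (q ^ 2)"
  shows "(\<Sum>r = - int i..int i. q powi (2 * r ^ 2 + r) * g (int i - r) * g (int i + r)) = 1 / qpoch q q (2 * i)"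
    and "(\<Sum>r = - int i - 1..int i. q powi (2 * r ^ 2 + r) * g (int i - r) * g (int i + 1 + r)) = 1 / qpoch q q (2 * i + 1)"
proof -
  define E where "E i = (\<Sum>r = - int i..int i. q powi (2 * r ^ 2 + r) * g (int i - r) * g (int i + r))" for i
  define F where "F i = (\<Sum>r = - int i - 1..int i. q powi (2 * r ^ 2 + r) * g (int i - r) * g (int i + 1 + r))" for i
  have q2: "norm (q ^ 2) < 1"
    using q by (simp add: norm_power power_less_one_iff)
  have rec: "g (k - 1) = (1 - q powi (2 * k)) * g k" for k
    unfolding g_def by (subst inv_qfact_rec[OF q2]) (simp add: power_int_mult)
  have EF: "E i = (1 - q ^ (2 * i + 1)) * F i" for i
  proof -
    \<comment> \<open>The added term \<open>r = - i - 1\<close> contains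
      \<open>g (- 1) = 0\<close>.\<close>
    have "E i = (\<Sum>r = - int i - 1..int i. q powi (2 * r ^ 2 + r) * g (int i - r) * g (int i + r))"
      unfolding E_def g_def by (rule sum.mono_neutral_left) auto
    also have "\<dots> = (\<Sum>r = - int i - 1..int i. q powi (2 * r ^ 2 + r) * g (int i - r) * g (int i + 1 + r)
        - q powi (2 * r ^ 2 + r) * q powi (2 * (int i + 1 + r)) * g (int i - r) * g (int i + 1 + r))"
    proof (rule sum.cong)
      fix r
      have *: "g (int i + r) = (1 - q powi (2 * (int i + 1 + r))) * g (int i + 1 + r)"
        using rec[of "int i + 1 + r"] by (simp add: algebra_simps)
      show "q powi (2 * r ^ 2 + r) * g (int i - r) * g (int i + r) =
          q powi (2 * r ^ 2 + r) * g (int i - r) * g (int i + 1 + r)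
        - q powi (2 * r ^ 2 + r) * q powi (2 * (int i + 1 + r)) * g (int i - r) * g (int i + 1 + r)"
        unfolding * by (simp add: algebra_simps)
    qed auto
    also have "\<dots> = F i - (\<Sum>r = - int i - 1..int i. q powi (2 * r ^ 2 + r) * q powi (2 * (int i + 1 + r)) * g (int i - r) * g (int i + 1 + r))"
      unfolding sum_subtractf F_def ..
    also have "(\<Sum>r = - int i - 1..int i. q powi (2 * r ^ 2 + r) * q powi (2 * (int i + 1 + r)) * g (int i - r) * g (int i + 1 + r)) =
      (\<Sum>r = - int i - 1..int i. q ^ (2 * i + 1) * (q powi (2 * r ^ 2 + r) * g (int i - r) * g (int i + 1 + r)))"
    \<comment> \<open>The reflection swaps the two \<open>g\<close> factors and turns
      \<open>2 r^2 + r\<close> into \<open>2 r^2 + 3 r + 1\<close>, which is \<open>2 i + 1\<close>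
      short of the exponent in the correction term.\<close>
    proof (rule sum.reindex_bij_witness[of _ "\<lambda>r. - 1 - r" "\<lambda>r. - 1 - r"])
      fix r
      have e: "q ^ (2 * i + 1) * q powi (2 * (- 1 - r) ^ 2 + (- 1 - r)) = q powi (2 * r ^ 2 + r) * q powi (2 * (int i + 1 + r))"
        using q by (simp add: power2_eq_square algebra_simps flip: power_int_of_nat power_int_add)
      have args: "g (int i - (- 1 - r)) = g (int i + 1 + r)" "g (int i + 1 + (- 1 - r)) = g (int i - r)"
        by (simp_all add: algebra_simps)
      show "q ^ (2 * i + 1) * (q powi (2 * (- 1 - r) ^ 2 + (- 1 - r)) * g (int i - (- 1 - r)) * g (int i + 1 + (- 1 - r))) =
          q powi (2 * r ^ 2 + r) * q powi (2 * (int i + 1 + r)) * g (int i - r) * g (int i + 1 + r)"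
        unfolding args mult.assoc[symmetric] e by (simp only: mult_ac)
    qed auto
    also have "\<dots> = q ^ (2 * i + 1) * F i"
      unfolding F_def sum_distrib_left ..
    finally show ?thesis by (simp add: algebra_simps)
  qed
  have FE: "F i = (1 - q ^ (2 * i + 2)) * E (Suc i)" for i
  proof -
    have "F i = (\<Sum>r = - int (Suc i)..int (Suc i). q powi (2 * r ^ 2 + r) * g (int i - r) * g (int i + 1 + r))"
      unfolding F_def g_def by (rule sum.mono_neutral_left) auto
    also have "\<dots> = (\<Sum>r = - int (Suc i)..int (Suc i). q powi (2 * r ^ 2 + r) * g (int (Suc i) - r) * g (int (Suc i) + r)
        - q powi (2 * r ^ 2 + r) * q powi (2 * (int (Suc i) - r)) * g (int (Suc i) - r) * g (int (Suc i) + r))"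
    proof (rule sum.cong)
      fix r
      have *: "g (int i - r) = (1 - q powi (2 * (int (Suc i) - r))) * g (int (Suc i) - r)"
        using rec[of "int (Suc i) - r"] by (simp add: algebra_simps)
      show "q powi (2 * r ^ 2 + r) * g (int i - r) * g (int i + 1 + r) =
          q powi (2 * r ^ 2 + r) * g (int (Suc i) - r) * g (int (Suc i) + r)
        - q powi (2 * r ^ 2 + r) * q powi (2 * (int (Suc i) - r)) * g (int (Suc i) - r) * g (int (Suc i) + r)"
        unfolding * by (simp add: algebra_simps)
    qed auto
    also have "\<dots> = E (Suc i) - (\<Sum>r = - int (Suc i)..int (Suc i). q powi (2 * r ^ 2 + r) * q powi (2 * (int (Suc i) - r)) * g (int (Suc i) - r) * g (int (Suc i) + r))"
      unfolding sum_subtractf E_def ..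
    also have "(\<Sum>r = - int (Suc i)..int (Suc i). q powi (2 * r ^ 2 + r) * q powi (2 * (int (Suc i) - r)) * g (int (Suc i) - r) * g (int (Suc i) + r)) =
      (\<Sum>r = - int (Suc i)..int (Suc i). q ^ (2 * i + 2) * (q powi (2 * r ^ 2 + r) * g (int (Suc i) - r) * g (int (Suc i) + r)))"
    proof (rule sum.reindex_bij_witness[of _ uminus uminus])
      fix r
      have e: "q ^ (2 * i + 2) * q powi (2 * (- r) ^ 2 + (- r)) = q powi (2 * r ^ 2 + r) * q powi (2 * (int (Suc i) - r))"
        using q by (simp add: power2_eq_square algebra_simps flip: power_int_of_nat power_int_add)
      have args: "g (int (Suc i) - (- r)) = g (int (Suc i) + r)" "g (int (Suc i) + (- r)) = g (int (Suc i) - r)"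
        by simp_all
      show "q ^ (2 * i + 2) * (q powi (2 * (- r) ^ 2 + (- r)) * g (int (Suc i) - (- r)) * g (int (Suc i) + (- r))) =
          q powi (2 * r ^ 2 + r) * q powi (2 * (int (Suc i) - r)) * g (int (Suc i) - r) * g (int (Suc i) + r)"
        unfolding args mult.assoc[symmetric] e by (simp only: mult_ac)
    qed auto
    also have "\<dots> = q ^ (2 * i + 2) * E (Suc i)"
      unfolding E_def sum_distrib_left ..
    finally show ?thesis by (simp add: algebra_simps)
  qed
  have nz: "1 - q ^ (2 * i + 1) \<noteq> 0" "1 - q ^ (2 * i + 2) \<noteq> 0" for i
    using power_neq_1[OF q(1), of "2 * i + 1"] power_neq_1[OF q(1), of "2 * i + 2"] by auto
  \<comment> \<open>The evaluation climbs alternately: \<open>E i\<close> determines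
    \<open>F i\<close> through \<open>EF\<close>, and \<open>F i\<close> determines
    \<open>E (Suc i)\<close> through \<open>FE\<close>.\<close>
  have F: "F i = 1 / qpoch q q (2 * i + 1)" if "E i = 1 / qpoch q q (2 * i)" for i
  proof -
    have *: "qpoch q q (2 * i + 1) = qpoch q q (2 * i) * (1 - q ^ (2 * i + 1))"
      by (simp add: qpoch_Suc)
    have "F i = E i / (1 - q ^ (2 * i + 1))"
      unfolding EF using nz(1)[of i] by (metis nonzero_mult_div_cancel_left)
    then show ?thesis
      unfolding that * by simp
  qed
  have E: "E i = 1 / qpoch q q (2 * i)" for i
  proof (induction i)
    case 0
    then show ?case by (simp add: E_def g_def qpoch_def)
  next
    case (Suc i)
    have *: "qpoch q q (2 * Suc i) = qpoch q q (2 * i + 1) * (1 - q ^ (2 * i + 2))"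
      by (simp add: qpoch_Suc)
    have "E (Suc i) = F i / (1 - q ^ (2 * i + 2))"
      unfolding FE using nz(2)[of i] by (metis nonzero_mult_div_cancel_left)
    then show ?case
      unfolding F[OF Suc.IH] * by simp
  qed
  show "(\<Sum>r = - int i..int i. q powi (2 * r ^ 2 + r) * g (int i - r) * g (int i + r)) = 1 / qpoch q q (2 * i)"
    using E[of i] unfolding E_def .
  show "(\<Sum>r = - int i - 1..int i. q powi (2 * r ^ 2 + r) * g (int i - r) * g (int i + 1 + r)) = 1 / qpoch q q (2 * i + 1)"
    using F[OF E, of i] unfolding F_def .
qed

text \<open>Treats both parities at once and extends the finite sum by zero terms to all integers,
  so that the range of \<open>r\<close> is independent of \<open>i\<close> when summations are
  interchanged.\<close>

lemma inv_qpoch_expansion: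
  assumes q: "norm q < 1" "q \<noteq> 0" and d: "d \<le> 1"
  shows "((\<lambda>r. q powi (2 * r ^ 2 + r) * inv_qfact (q ^ 2) (int i - r) * inv_qfact (q ^ 2) (int i + r + int d))
    has_sum (1 / qpoch q q (2 * i + d))) UNIV"
proof (rule has_sum_finite_neutralI[of "{- int i - int d..int i}"])
  show "1 / qpoch q q (2 * i + d) = (\<Sum>r = - int i - int d..int i.
      q powi (2 * r ^ 2 + r) * inv_qfact (q ^ 2) (int i - r) * inv_qfact (q ^ 2) (int i + r + int d))"
  proof (cases "d = 0")
    case True
    then show ?thesis using inv_qpoch_expansion_even_odd(1)[OF q, of i] by simp
  next
    case False
    then have "d = 1" using d by simp
    then show ?thesis using inv_qpoch_expansion_even_odd(2)[OF q, of i] by (simp add: ac_simps)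
  qed
qed (auto simp: not_le)

section \<open>The q-Vandermonde sum and the Bailey transform\<close>

text \<open>The induction works because \<open>1 - q\<^bsup>N+1\<^esup>\<close> times the sum for \<open>(N + 1, b)\<close> collapses to the sum for
  \<open>(N, b + 1)\<close>.\<close>

lemma inv_qfact_vandermonde:
  assumes q: "norm q < 1" "q \<noteq> 0"
  shows "(\<Sum>s\<le>N. q powi (int s * (int s + b)) * inv_qfact q (int N - int s) * inv_qfact q (int s) * inv_qfact q (int s + b)) =
    inv_qfact q (int N) * inv_qfact q (int N + b)"
proof (induction N arbitrary: b)
  case 0
  then show ?case by simp
next
  case (Suc N)
  let ?g = "inv_qfact q"
  define T where "T s = q powi (int s * (int s + b)) * ?g (int (Suc N) - int s) * ?g (int s) * ?g (int s + b)" for s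
  define U where "U s = q powi (int s * (int s + b)) * q powi int s * ?g (int N - int s) * ?g (int s) * ?g (int s + b)" for s
  define V where "V s = q powi (int s * (int s + b)) * ?g (int N + 1 - int s) * ?g (int s - 1) * ?g (int s + b)" for s
  \<comment> \<open>Splits \<open>1 - q^(N+1) = q^s (1 - q^(N+1-s)) + (1 - q^s)\<close>.\<close>
  have pascal: "(1 - q ^ Suc N) * T s = U s + V s" for s
  proof -
    have e: "q ^ Suc N = q powi int s * q powi (int N + 1 - int s)"
      using q by (simp add: ac_simps del: power_Suc flip: power_int_of_nat power_int_add)
    have g: "?g (int N - int s) = (1 - q powi (int N + 1 - int s)) * ?g (int N + 1 - int s)"
      using inv_qfact_rec[OF q(1), of "int N + 1 - int s"] by (simp add: algebra_simps)
    have h: "int (Suc N) - int s = int N + 1 - int s" by simp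
    show ?thesis
      unfolding T_def U_def V_def e g h inv_qfact_rec[OF q(1), of "int s"]
      by (simp add: algebra_simps del: power_int_of_nat)
  qed
  \<comment> \<open>Pairing \<open>U s\<close> with the next \<open>V\<close> makes the parts
    containing \<open>q powi (s + b + 1)\<close> cancel.\<close>
  have UV: "U s + V (Suc s) = q powi (int s * (int s + (b + 1))) * ?g (int N - int s) * ?g (int s) * ?g (int s + (b + 1))" for s
  proof -
    have g: "?g (int s + b) = (1 - q powi (int s + (b + 1))) * ?g (int s + (b + 1))"
      using inv_qfact_rec[OF q(1), of "int s + (b + 1)"] by (simp add: algebra_simps)
    have e1: "q powi (int s * (int s + b)) * q powi int s = q powi (int s * (int s + (b + 1)))"
      using q by (simp add: algebra_simps flip: power_int_add del: power_int_of_nat)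
    have e2: "q powi (int (Suc s) * (int (Suc s) + b)) = q powi (int s * (int s + (b + 1))) * q powi (int s + (b + 1))"
      using q by (simp add: algebra_simps flip: power_int_add del: power_int_of_nat)
    have h: "int N + 1 - int (Suc s) = int N - int s" "int (Suc s) - 1 = int s"
      "int (Suc s) + b = int s + (b + 1)"
      by simp_all
    show ?thesis
      unfolding U_def V_def e1 e2 unfolding h g by (simp add: algebra_simps)
  qed
  have "(1 - q ^ Suc N) * sum T {..Suc N} = sum U {..Suc N} + sum V {..Suc N}"
    unfolding sum_distrib_left pascal sum.distrib ..
  also have "sum U {..Suc N} = sum U {..N}"
    by (simp add: U_def)
  also have "sum V {..Suc N} = (\<Sum>s\<le>N. V (Suc s))"
    unfolding sum.atMost_Suc_shift by (simp add: V_def)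
  also have "sum U {..N} + (\<Sum>s\<le>N. V (Suc s)) = ?g (int N) * ?g (int N + (b + 1))"
    unfolding sum.distrib[symmetric] UV Suc.IH ..
  also have "?g (int N) = (1 - q ^ Suc N) * ?g (int (Suc N))"
    using inv_qfact_rec[OF q(1), of "int (Suc N)"] by (simp flip: power_int_of_nat)
  also have "int N + (b + 1) = int (Suc N) + b"
    by simp
  finally have "(1 - q ^ Suc N) * sum T {..Suc N} = (1 - q ^ Suc N) * (?g (int (Suc N)) * ?g (int (Suc N) + b))"
    by (simp only: mult.assoc)
  moreover have "1 - q ^ Suc N \<noteq> 0"
    using power_neq_1[OF q(1), of "Suc N"] by auto
  ultimately show ?case
    unfolding T_def by simp
qed

text \<open>Substituting \<open>i = r + s\<close> reduces this to
  \<open>inv_qfact_vandermonde\<close> with \<open>N = n - r\<close> and \<open>b = 2 r + d\<close>;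
  for \<open>r > n\<close> both sides vanish.\<close>

lemma bailey_transform_finite:
  assumes q: "norm q < 1" "q \<noteq> 0" and d: "d \<le> (1::nat)"
  shows "(\<Sum>i\<le>n. q ^ (i ^ 2 + d * i) * inv_qfact q (int n - int i) * inv_qfact q (int i - r) * inv_qfact q (int i + r + int d)) =
    q powi (r ^ 2 + int d * r) * inv_qfact q (int n - r) * inv_qfact q (int n + r + int d)"
proof -
  let ?g = "inv_qfact q"
  define h where "h i = q powi (i ^ 2 + int d * i) * ?g (int n - i) * ?g (i - r) * ?g (i + r + int d)" for i
  have "(\<Sum>i\<le>n. q ^ (i ^ 2 + d * i) * ?g (int n - int i) * ?g (int i - r) * ?g (int i + r + int d)) = (\<Sum>i\<le>n. h (int i))"
    unfolding h_def by (intro sum.cong) (simp_all flip: power_int_of_nat)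
  also have "\<dots> = sum h {0..int n}"
    by (rule sum.reindex_bij_witness[of _ nat int]) auto
  \<comment> \<open>For negative \<open>r\<close> the new terms have \<open>r <= i < 0\<close>,
    hence \<open>i + r + d <= - 1\<close> since \<open>d <= 1\<close>, and the last factor is
    zero.\<close>
  also have "\<dots> = sum h {min r 0..int n}"
    using d by (intro sum.mono_neutral_left) (auto simp: h_def min_def split: if_splits)
  also have "\<dots> = sum h {r..int n}"
    by (intro sum.mono_neutral_right) (auto simp: h_def)
  also have "\<dots> = q powi (r ^ 2 + int d * r) * ?g (int n - r) * ?g (int n + r + int d)"
  proof (cases "r \<le> int n")
    case True
    define N where "N = nat (int n - r)"
    have N: "int N = int n - r"
      unfolding N_def using True by simp
    have "sum h {r..int n} = (\<Sum>s\<le>N. q powi (r ^ 2 + int d * r) *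
        (q powi (int s * (int s + (2 * r + int d))) * ?g (int N - int s) * ?g (int s) * ?g (int s + (2 * r + int d))))"
    proof (rule sum.reindex_bij_witness[of _ "\<lambda>s. r + int s" "\<lambda>i. nat (i - r)"])
      fix i assume i: "i \<in> {r..int n}"
      define s where "s = nat (i - r)"
      have s: "i = r + int s" unfolding s_def using i by simp
      have e: "q powi (i ^ 2 + int d * i) = q powi (r ^ 2 + int d * r) * q powi (int s * (int s + (2 * r + int d)))"
        unfolding s using q by (simp add: power2_eq_square algebra_simps flip: power_int_add)
      have args: "int n - i = int N - int s" "i - r = int s" "i + r + int d = int s + (2 * r + int d)"
        unfolding N s by simp_all
      show "q powi (r ^ 2 + int d * r) * (q powi (int (nat (i - r)) * (int (nat (i - r)) + (2 * r + int d))) *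
          ?g (int N - int (nat (i - r))) * ?g (int (nat (i - r))) * ?g (int (nat (i - r)) + (2 * r + int d))) = h i"
        unfolding s_def[symmetric] h_def e args by (simp add: mult.assoc)
    qed (use N in auto)
    also have "\<dots> = q powi (r ^ 2 + int d * r) * (?g (int N) * ?g (int N + (2 * r + int d)))"
      unfolding sum_distrib_left[symmetric] inv_qfact_vandermonde[OF q] ..
    also have "int N + (2 * r + int d) = int n + r + int d"
      unfolding N by simp
    finally show ?thesis
      unfolding N by (simp add: mult.assoc)
  qed auto
  finally show ?thesis .
qed

text \<open>The limit of \<open>bailey_transform_finite\<close> as \<open>n\<close> grows: the
  factors containing \<open>n\<close> tend to \<open>1 / P\<close>, one on the left and two on the
  right, so one survives.\<close>

lemma bailey_transform_limit:
  assumes q: "norm q < 1" "q \<noteq> 0" and d: "d \<le> (1::nat)"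
  shows "((\<lambda>i. q ^ (i ^ 2 + d * i) * inv_qfact q (int i - r) * inv_qfact q (int i + r + int d))
    has_sum (q powi (r ^ 2 + int d * r) / qpoch_inf q q)) UNIV"
proof -
  obtain C where C: "C > 0" "\<And>k. norm (inv_qfact q k) \<le> C"
    using inv_qfact_bounded[OF q(1)] by blast
  define P where "P = qpoch_inf q q"
  have P: "P \<noteq> 0"
    unfolding P_def by (rule qpoch_inf_self_nonzero[OF q(1)])
  have "((\<lambda>i. q ^ (i ^ 2 + d * i) * (1 / P) * inv_qfact q (int i - r) * inv_qfact q (int i + r + int d))
    has_sum (q powi (r ^ 2 + int d * r) * (1 / P) * (1 / P))) UNIV"
  proof (rule has_sum_dominated_convergence)
    show "(\<lambda>i. norm q ^ i * C * C * C) summable_on UNIV"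
      using q by (intro summable_on_cmult_left summable_on_power_nat) auto
    show "norm (q ^ (i ^ 2 + d * i) * inv_qfact q (int n + (- int i)) * inv_qfact q (int i - r) * inv_qfact q (int i + r + int d))
        \<le> norm q ^ i * C * C * C" for n i
      unfolding norm_mult norm_power using C q(1)
      by (intro mult_mono power_decreasing) (auto simp: power2_eq_square intro!: trans_le_add1)
    show "(\<lambda>n. q ^ (i ^ 2 + d * i) * inv_qfact q (int n + (- int i)) * inv_qfact q (int i - r) * inv_qfact q (int i + r + int d))
        \<longlonglongrightarrow> q ^ (i ^ 2 + d * i) * (1 / P) * inv_qfact q (int i - r) * inv_qfact q (int i + r + int d)" for i
      unfolding P_def by (intro tendsto_intros inv_qfact_tendsto q)
    show "((\<lambda>i. q ^ (i ^ 2 + d * i) * inv_qfact q (int n + (- int i)) * inv_qfact q (int i - r) * inv_qfact q (int i + r + int d))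
        has_sum (q powi (r ^ 2 + int d * r) * inv_qfact q (int n + (- r)) * inv_qfact q (int n + (r + int d)))) UNIV" for n
      using bailey_transform_finite[OF q d, of n r]
      by (intro has_sum_finite_neutralI[of "{..n}"]) (auto simp: ac_simps)
    show "(\<lambda>n. q powi (r ^ 2 + int d * r) * inv_qfact q (int n + (- r)) * inv_qfact q (int n + (r + int d)))
        \<longlonglongrightarrow> q powi (r ^ 2 + int d * r) * (1 / P) * (1 / P)"
      unfolding P_def by (intro tendsto_intros inv_qfact_tendsto q)
  qed
  from has_sum_cmult_left[OF this, of P] show ?thesis
    using P by (simp add: field_simps flip: P_def)
qed

section \<open>The theta series with exponents \<open>6 r^2 + k r\<close>\<close>

text \<open>For \<open>r <= - 1\<close> the integer \<open>m r + k\<close> is at most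
  \<open>k - m <= - 1\<close>, and for \<open>r >= 1\<close> it is at least 1. Thus the exponent is
  at least the absolute value of \<open>r\<close>.\<close>

lemma norm_quadratic_powi_le:
  fixes q :: complex and k m r :: int
  assumes q: "norm q < 1" and k: "0 \<le> k" "k < m"
  shows "norm (q powi (m * r ^ 2 + k * r)) \<le> norm q ^ nat \<bar>r\<bar>"
proof -
  have le: "\<bar>r\<bar> \<le> m * r ^ 2 + k * r"
  proof (cases "r \<ge> 1")
    case True
    then have "1 * 1 \<le> m * r" using k by (intro mult_mono) auto
    then have "r * 1 \<le> r * (m * r + k)" using True k by (intro mult_left_mono) auto
    then show ?thesis using True by (simp add: power2_eq_square algebra_simps)
  next
    case False
    show ?thesis
    proof (cases "r = 0")
      case False
      then have "m * r \<le> m * (- 1)" using \<open>\<not> r \<ge> 1\<close> k by (intro mult_left_mono) auto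
      then have "r * (m * r + k) \<ge> r * (- 1)" using \<open>\<not> r \<ge> 1\<close> k by (intro mult_left_mono_neg) auto
      then show ?thesis using \<open>\<not> r \<ge> 1\<close> by (simp add: power2_eq_square algebra_simps)
    qed simp
  qed
  then have "q powi (m * r ^ 2 + k * r) = q ^ nat (m * r ^ 2 + k * r)"
    by (intro power_int_nonneg_exp) auto
  then show ?thesis
    unfolding norm_power using le q by (auto simp: norm_power intro!: power_decreasing)
qed

text \<open>Consecutive terms have ratio \<open>q^(6+k) q^(12r)\<close>, so the triple product
  applies with \<open>a = q^(6+k)\<close>, \<open>b = q^(6-k)\<close> and base
  \<open>a b = q^12\<close>.\<close>

lemma theta_has_sum:
  assumes q: "norm q < 1" "q \<noteq> 0" and k: "k \<le> 5"
  shows "((\<lambda>r. q powi (6 * r ^ 2 + int k * r)) has_sum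
    (qpoch_inf (- (q ^ (6 - k))) (q ^ 12) * qpoch_inf (- (q ^ (6 + k))) (q ^ 12) * qpoch_inf (q ^ 12) (q ^ 12))) UNIV"
proof -
  let ?c = "\<lambda>r. q powi (6 * r ^ 2 + int k * r)"
  have "(?c has_sum (qpoch_inf (- (q ^ (6 + k))) (q ^ 12) * qpoch_inf (- (q ^ (6 - k))) (q ^ 12) * qpoch_inf (q ^ 12) (q ^ 12))) UNIV"
  proof (rule jacobi_triple_product_has_sum)
    show "norm (q ^ 12) < 1" "q ^ 12 \<noteq> 0"
      using q by (auto simp: norm_power power_less_one_iff)
    show "?c (r + 1) = q ^ (6 + k) * (q ^ 12) powi r * ?c r" for r
    proof -
      have "q ^ (6 + k) * (q ^ 12) powi r * ?c r = q powi (int (6 + k) + 12 * r + (6 * r ^ 2 + int k * r))"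
        using q by (simp add: power_int_add power_int_power power_add)
      also have "int (6 + k) + 12 * r + (6 * r ^ 2 + int k * r) = 6 * (r + 1) ^ 2 + int k * (r + 1)"
        by (simp add: power2_eq_square algebra_simps)
      finally show ?thesis ..
    qed
    show "?c (- (r + 1)) = q ^ (6 - k) * (q ^ 12) powi r * ?c (- r)" for r
    proof -
      have "q ^ (6 - k) * (q ^ 12) powi r * ?c (- r) = q powi (int (6 - k) + 12 * r + (6 * (- r) ^ 2 + int k * (- r)))"
        using q by (simp add: power_int_add power_int_power del: of_nat_diff)
      also have "int (6 - k) + 12 * r + (6 * (- r) ^ 2 + int k * (- r)) = 6 * (- (r + 1)) ^ 2 + int k * (- (r + 1))"
        using k by (simp add: power2_eq_square algebra_simps of_nat_diff)
      finally show ?thesis ..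
    qed
    show "(\<lambda>r. norm (?c r)) summable_on UNIV"
    proof (rule summable_on_comparison_test)
      show "(\<lambda>r::int. norm q ^ nat \<bar>r\<bar>) summable_on UNIV"
        using q by (intro summable_on_power_abs_int) auto
      show "norm (?c r) \<le> norm q ^ nat \<bar>r\<bar>" for r
        using k by (intro norm_quadratic_powi_le q) auto
    qed auto
  qed simp
  then show ?thesis
    by (simp add: mult.commute)
qed

section \<open>Interchange of summation and the double series\<close>

lemma summable_on_mult_Times:
  fixes u :: "'a \<Rightarrow> real" and v :: "'b \<Rightarrow> real"
  assumes "u summable_on A" "v summable_on B"
    and "\<And>x. x \<in> A \<Longrightarrow> u x \<ge> 0" "\<And>y. y \<in> B \<Longrightarrow> v y \<ge> 0"
  shows "(\<lambda>(x, y). u x * v y) summable_on A \<times> B"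
proof (rule summable_on_SigmaI[where g = "\<lambda>x. u x * infsum v B"])
  show "((\<lambda>y. case (x, y) of (x, y) \<Rightarrow> u x * v y) has_sum u x * infsum v B) B" for x
    using assms by (auto intro!: has_sum_cmult_right)
  show "(\<lambda>x. u x * infsum v B) summable_on A"
    using assms by (intro summable_on_cmult_left)
qed (use assms in auto)

text \<open>Expanding the reciprocal of \<open>qpoch q q (2 * i + d)\<close> gives an absolutely
  convergent triple sum. Summing over \<open>r\<close> first recovers the double sum; summing over
  \<open>i\<close>, then \<open>n\<close>, then \<open>r\<close> applies the Bailey transform twice
  and leaves the theta series.\<close>

lemma bailey_double_sum:
  assumes q: "norm q < 1" "q \<noteq> 0" and d: "d \<le> (1::nat)"
    and S: "((\<lambda>r. q powi (6 * r ^ 2 + int (1 + 4 * d) * r)) has_sum S) UNIV"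
  shows "((\<lambda>(n, i). (q ^ 2) ^ (n ^ 2 + d * n) * (q ^ 2) ^ (i ^ 2 + d * i) * inv_qfact (q ^ 2) (int n - int i)
      * (1 / qpoch q q (2 * i + d))) has_sum (S / qpoch_inf (q ^ 2) (q ^ 2))) UNIV"
proof -
  define Q where "Q = q ^ 2"
  let ?g = "inv_qfact Q"
  have Q: "norm Q < 1" "Q \<noteq> 0"
    using q by (auto simp: Q_def norm_power power_less_one_iff)
  obtain C where C: "C > 0" "\<And>k. norm (?g k) \<le> C"
    using inv_qfact_bounded[OF Q(1)] by blast
  define H :: "(nat \<times> nat) \<times> int \<Rightarrow> complex" where
    "H = (\<lambda>((n, i), r). (Q ^ (n ^ 2 + d * n) * Q ^ (i ^ 2 + d * i) * ?g (int n - int i)) *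
      (q powi (2 * r ^ 2 + r) * ?g (int i - r) * ?g (int i + r + int d)))"
  have Q_le: "norm (Q ^ (n ^ 2 + d * n)) \<le> norm q ^ n" for n
  proof -
    have "n \<le> 2 * (n ^ 2 + d * n)" by (auto simp: power2_eq_square intro!: trans_le_add1)
    then show ?thesis
      using q unfolding Q_def norm_power power_mult[symmetric] by (intro power_decreasing) auto
  qed
  have "(\<lambda>x. norm (H x)) summable_on (UNIV \<times> UNIV)"
  proof (rule Infinite_Sum.abs_summable_on_comparison_test')
    have "(\<lambda>(x, r). (\<lambda>(n, i). norm q ^ n * norm q ^ i) x * norm q ^ nat \<bar>r::int\<bar>) summable_on (UNIV \<times> UNIV) \<times> UNIV"
      using q by (intro summable_on_mult_Times summable_on_power_nat summable_on_power_abs_int) auto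
    then show "(\<lambda>x. C * C * C * (\<lambda>(x, r). (\<lambda>(n, i). norm q ^ n * norm q ^ i) x * norm q ^ nat \<bar>r::int\<bar>) x) summable_on UNIV \<times> UNIV"
      by (intro summable_on_cmult_right) simp
    fix x :: "(nat \<times> nat) \<times> int"
    obtain n i r where x: "x = ((n, i), r)" by (metis surj_pair)
    have "norm (q powi (2 * r ^ 2 + r)) \<le> norm q ^ nat \<bar>r\<bar>"
      using norm_quadratic_powi_le[OF q(1), of 1 2 r] by simp
    then have "norm (H x) \<le> (norm q ^ n * norm q ^ i * C) * (norm q ^ nat \<bar>r\<bar> * C * C)"
      unfolding x H_def case_prod_conv norm_mult using C
      by (intro mult_mono Q_le mult_nonneg_nonneg) auto
    then show "norm (H x) \<le> C * C * C * (\<lambda>(x, r). (\<lambda>(n, i). norm q ^ n * norm q ^ i) x * norm q ^ nat \<bar>r::int\<bar>) x"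
      unfolding x by (simp add: algebra_simps)
  qed
  then have H_summable: "H summable_on (UNIV \<times> UNIV)"
    by (rule Infinite_Sum.abs_summable_summable)
  then obtain T where T: "(H has_sum T) (UNIV \<times> UNIV)"
    by (auto simp: summable_on_def)
  have rows: "((\<lambda>(n, i). Q ^ (n ^ 2 + d * n) * Q ^ (i ^ 2 + d * i) * ?g (int n - int i) * (1 / qpoch q q (2 * i + d))) has_sum T) UNIV"
    using T
  proof (rule has_sum_SigmaD)
    fix x :: "nat \<times> nat"
    show "((\<lambda>r. H (x, r)) has_sum (\<lambda>(n, i). Q ^ (n ^ 2 + d * n) * Q ^ (i ^ 2 + d * i) * ?g (int n - int i) * (1 / qpoch q q (2 * i + d))) x) UNIV"
      unfolding H_def Q_def
      by (cases x, simp only: case_prod_conv) (intro has_sum_cmult_right inv_qpoch_expansion[OF q d])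
  qed
  have T': "((\<lambda>(r, x). H (x, r)) has_sum T) (UNIV \<times> UNIV)"
    using T by (subst (asm) has_sum_swap)
  \<comment> \<open>Second evaluation of \<open>T\<close>, with \<open>r\<close> outermost: for
    fixed \<open>r\<close> the sum over \<open>i\<close> is finite, and its result is again of the
    form summed by \<open>bailey_transform_limit\<close>.\<close>
  have "((\<lambda>r. q powi (6 * r ^ 2 + int (1 + 4 * d) * r) / qpoch_inf Q Q) has_sum T) UNIV"
    using T'
  proof (rule has_sum_SigmaD)
    fix r :: int
    have "(\<lambda>x. H (x, r)) summable_on UNIV"
      using summable_on_SigmaD1[of "\<lambda>r x. H (x, r)" UNIV "\<lambda>_. UNIV" r] T' by (auto simp: summable_on_def)
    then obtain K where K: "((\<lambda>x. H (x, r)) has_sum K) (UNIV \<times> UNIV)"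
      by (auto simp: summable_on_def)
    have "((\<lambda>n. q powi (2 * r ^ 2 + r) * Q powi (r ^ 2 + int d * r) *
        (Q ^ (n ^ 2 + d * n) * ?g (int n - r) * ?g (int n + r + int d))) has_sum K) UNIV"
      using K
    proof (rule has_sum_SigmaD)
      fix n :: nat
      have "((\<lambda>i. q powi (2 * r ^ 2 + r) * Q ^ (n ^ 2 + d * n) *
          (Q ^ (i ^ 2 + d * i) * ?g (int n - int i) * ?g (int i - r) * ?g (int i + r + int d))) has_sum
          q powi (2 * r ^ 2 + r) * Q ^ (n ^ 2 + d * n) *
          (Q powi (r ^ 2 + int d * r) * ?g (int n - r) * ?g (int n + r + int d))) UNIV"
        using bailey_transform_finite[OF Q d, of n r]
        by (intro has_sum_cmult_right has_sum_finite_neutralI[of "{..n}"]) auto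
      then show "((\<lambda>i. H ((n, i), r)) has_sum q powi (2 * r ^ 2 + r) * Q powi (r ^ 2 + int d * r) *
          (Q ^ (n ^ 2 + d * n) * ?g (int n - r) * ?g (int n + r + int d))) UNIV"
        unfolding H_def by (simp add: ac_simps)
    qed
    moreover have "((\<lambda>n. q powi (2 * r ^ 2 + r) * Q powi (r ^ 2 + int d * r) *
        (Q ^ (n ^ 2 + d * n) * ?g (int n - r) * ?g (int n + r + int d))) has_sum
        q powi (2 * r ^ 2 + r) * Q powi (r ^ 2 + int d * r) * (Q powi (r ^ 2 + int d * r) / qpoch_inf Q Q)) UNIV"
      by (intro has_sum_cmult_right bailey_transform_limit Q d)
    ultimately have "K = q powi (2 * r ^ 2 + r) * Q powi (r ^ 2 + int d * r) * (Q powi (r ^ 2 + int d * r) / qpoch_inf Q Q)"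
      by (rule has_sum_unique)
    also have "\<dots> = q powi (2 * r ^ 2 + r + 2 * (r ^ 2 + int d * r) + 2 * (r ^ 2 + int d * r)) / qpoch_inf Q Q"
    proof -
      have *: "q powi (x + 2 * y + 2 * z) = q powi x * Q powi y * Q powi z" for x y z
        using q by (simp add: power_int_add Q_def power_int_power)
      show ?thesis unfolding * by (rule times_divide_eq_right)
    qed
    also have "2 * r ^ 2 + r + 2 * (r ^ 2 + int d * r) + 2 * (r ^ 2 + int d * r) = 6 * r ^ 2 + int (1 + 4 * d) * r"
      by (simp add: algebra_simps)
    finally show "((\<lambda>x. case (r, x) of (r, x) \<Rightarrow> H (x, r)) has_sum q powi (6 * r ^ 2 + int (1 + 4 * d) * r) / qpoch_inf Q Q) UNIV"
      using K by simp
  qed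
  moreover have "((\<lambda>r. q powi (6 * r ^ 2 + int (1 + 4 * d) * r) / qpoch_inf Q Q) has_sum (S / qpoch_inf Q Q)) UNIV"
    by (intro has_sum_divide_const S)
  ultimately have "T = S / qpoch_inf Q Q"
    by (rule has_sum_unique)
  with rows show ?thesis
    unfolding Q_def by simp
qed

lemma double_sum_has_sum:
  assumes q: "norm q < 1" and d: "d \<le> (1::nat)"
  shows "((\<lambda>(i, j). q ^ (4 * i ^ 2 + 4 * i * j + 2 * j ^ 2 + d * (4 * i + 2 * j))
        / (qpoch q q (2 * i + d) * qpoch (q ^ 2) (q ^ 2) j)) has_sum
      (qpoch_inf (- (q ^ (5 - 4 * d))) (q ^ 12) * qpoch_inf (- (q ^ (7 + 4 * d))) (q ^ 12) * qpoch_inf (q ^ 12) (q ^ 12)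
        / qpoch_inf (q ^ 2) (q ^ 2))) UNIV"
\<comment> \<open>The expansions use negative powers of \<open>q\<close>, so \<open>q = 0\<close> is
  checked directly: only the term \<open>(0, 0)\<close> survives and both sides equal 1.\<close>
proof (cases "q = 0")
  case True
  have powers: "q ^ (5 - 4 * d) = 0" "q ^ (7 + 4 * d) = 0" "q ^ 12 = 0" "q ^ 2 = 0"
    using True d by simp_all
  have "qpoch_inf (- (q ^ (5 - 4 * d))) (q ^ 12) * qpoch_inf (- (q ^ (7 + 4 * d))) (q ^ 12) * qpoch_inf (q ^ 12) (q ^ 12)
        / qpoch_inf (q ^ 2) (q ^ 2) = 1"
    unfolding powers by (simp add: qpoch_inf_def)
  then show ?thesis
    by (intro has_sum_finite_neutralI[of "{(0, 0)}"]) (use True in \<open>auto simp: qpoch_def power_0_left split: if_splits\<close>)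
next
  case False
  let ?S = "qpoch_inf (- (q ^ (5 - 4 * d))) (q ^ 12) * qpoch_inf (- (q ^ (7 + 4 * d))) (q ^ 12) * qpoch_inf (q ^ 12) (q ^ 12)"
  define F where "F = (\<lambda>(n, i). (q ^ 2) ^ (n ^ 2 + d * n) * (q ^ 2) ^ (i ^ 2 + d * i) * inv_qfact (q ^ 2) (int n - int i)
      * (1 / qpoch q q (2 * i + d)))"
  \<comment> \<open>This is \<open>n = i + j\<close>. The range of \<open>h\<close> is
    \<open>i <= n\<close>, and outside it the factor \<open>inv_qfact (q ^ 2) (n - i)\<close> makes
    \<open>F\<close> vanish.\<close>
  define h :: "nat \<times> nat \<Rightarrow> nat \<times> nat" where "h = (\<lambda>(i, j). (i + j, i))"
  have "((\<lambda>r. q powi (6 * r ^ 2 + int (1 + 4 * d) * r)) has_sum ?S) UNIV"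
    using theta_has_sum[OF q False, of "1 + 4 * d"] d by simp
  from bailey_double_sum[OF q False d this]
  have "(F has_sum (?S / qpoch_inf (q ^ 2) (q ^ 2))) UNIV"
    unfolding F_def .
  also have "?this \<longleftrightarrow> (F has_sum (?S / qpoch_inf (q ^ 2) (q ^ 2))) (range h)"
  proof (rule has_sum_cong_neutral)
    fix x assume x: "x \<in> UNIV - range h"
    obtain n i where ni: "x = (n, i)" by (cases x)
    have "n < i"
    proof (rule ccontr)
      assume "\<not> n < i"
      then have "x = h (i, n - i)" unfolding ni h_def by simp
      with x show False by blast
    qed
    then show "F x = 0" unfolding ni F_def by simp
  qed auto
  also have "\<dots> \<longleftrightarrow> ((F \<circ> h) has_sum (?S / qpoch_inf (q ^ 2) (q ^ 2))) UNIV"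
    by (intro has_sum_reindex injI) (auto simp: h_def)
  also have "F \<circ> h = (\<lambda>(i, j). q ^ (4 * i ^ 2 + 4 * i * j + 2 * j ^ 2 + d * (4 * i + 2 * j))
        / (qpoch q q (2 * i + d) * qpoch (q ^ 2) (q ^ 2) j))"
  proof
    fix x :: "nat \<times> nat"
    obtain i j where ij: "x = (i, j)" by (cases x)
    have "(q ^ 2) ^ ((i + j) ^ 2 + d * (i + j)) * (q ^ 2) ^ (i ^ 2 + d * i) =
        q ^ (4 * i ^ 2 + 4 * i * j + 2 * j ^ 2 + d * (4 * i + 2 * j))"
      unfolding power_mult[symmetric] power_add[symmetric] by (simp add: power2_eq_square algebra_simps)
    then show "(F \<circ> h) x = (\<lambda>(i, j). q ^ (4 * i ^ 2 + 4 * i * j + 2 * j ^ 2 + d * (4 * i + 2 * j))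
        / (qpoch q q (2 * i + d) * qpoch (q ^ 2) (q ^ 2) j)) x"
      unfolding ij F_def h_def by (simp add: inv_qfact_of_nat)
  qed
  finally show ?thesis .
qed

theorem theorem3p1:
  fixes q :: complex
  assumes "norm q < 1"
  shows "((\<lambda>(i,j). q ^ (4*i^2 + 4*i*j + 2*j^2) / (qpoch q q (2*i) * qpoch (q^2) (q^2) j))
            has_sum (qpoch_inf (-(q^5)) (q^12) * qpoch_inf (-(q^7)) (q^12) * qpoch_inf (q^12) (q^12)
                     / qpoch_inf (q^2) (q^2))) (UNIV :: (nat \<times> nat) set)
    \<and> ((\<lambda>(i,j). q ^ (4*i^2 + 4*i*j + 2*j^2 + 4*i + 2*j) / (qpoch q q (2*i+1) * qpoch (q^2) (q^2) j))
            has_sum (qpoch_inf (-q) (q^12) * qpoch_inf (-(q^11)) (q^12) * qpoch_inf (q^12) (q^12)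
                     / qpoch_inf (q^2) (q^2))) (UNIV :: (nat \<times> nat) set)"
  using double_sum_has_sum[OF assms, of 0] double_sum_has_sum[OF assms, of 1]
  by (simp add: add.assoc)

end
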